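(* Let $\mathcal P'$ be the set of packing paths and let $\mathcal Q$ be the set of quarter-plane paths starting at the origin, ending on the $x$-axis, with steps $u=(1,1)$, $d=(1,-1)$, $f=(1,0)$, in which every step $d$ is immediately followed by at least one step $f$ and every step $f$ immediately follows a step $d$ or another step $f$. Define $g:\mathcal P'\to\mathcal Q$ recursively by $g(\varepsilon)=\varepsilon$ and, for $P\ne\varepsilon$, $$g(P)=\begin{cases} u\,g(Q)\,d\,ff\,(ff)^k\,g(R) & \text{if } P=U(F\overline F)^k\,\overline U\,Q\,\overline D D\,R\text{ with } k\ge0,\ Q,R\in\mathcal P',\\ u\,g(Q)\,d\,f\,(ff)^k\,g(US) & \text{if } P=U(F\overline F)^k\,\overline U\,Q\,\overline D\,\overline F\,S\text{ with } k\ge0,\ Q,\,US\in\mathcal P',\\ u\,g(R)\,d\,f\,(ff)^k & \text{if } P=UF(\overline F F)^kD\,R\text{ with } k\ge0,\ R\in\mathcal P'. \end{cases}$$ Then $g$ is a bijection from $\mathcal P'$ onto $\mathcal Q$.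
   Context: Consider the hexagonal packing of the plane by circles of radius $2$ with centers $(2+4i+2j,\,2\sqrt3\,j)$, $i,j\in\mathbb Z$; the origin is the tangency point of two horizontally adjacent circles. The tangency points cut every circle into six arcs. Traversed from left to right these give six types of steps (angles measured on the circle carrying the arc): $U$ from $180^\circ$ to $120^\circ$ (displacement $(1,\sqrt3)$), $F$ from $120^\circ$ to $60^\circ$ (displacement $(2,0)$), $D$ from $60^\circ$ to $0^\circ$ (displacement $(1,-\sqrt3)$), $\overline U$ from $300^\circ$ to $360^\circ$ (displacement $(1,\sqrt3)$), $\overline F$ from $240^\circ$ to $300^\circ$ (displacement $(2,0)$), $\overline D$ from $180^\circ$ to $240^\circ$ (displacement $(1,-\sqrt3)$). A path in the packing starts at the origin, is a concatenation of such arcs of circles of the packing, each starting where the previous one ends, and stays in the quarter plane $x,y\ge 0$. Equivalently, it is a word in $\{U,F,D,\overline U,\overline F,\overline D\}$ whose first step (if any) is $U$, in which $U$ or $\overline F$ can only be followed by $F$ or $\overline U$; $F$ or $\overline D$ only by $\overline F$ or $D$; $\overline U$ or $D$ only by $U$ or $\overline D$; and which never goes below ordinate $0$. A packing path is such a path ending on the $x$-axis; $\mathcal P'$ is the set of all packing paths, identified with words, including the empty path $\varepsilon$. The empty path also belongs to $\mathcal Q$. *)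

theory Defs
  imports "HOL-Complex_Analysis.Contour_Integration"
begin

section \<open>Paths in the hexagonal circle packing\<close>

text \<open>The plane is identified with \<^typ>\<open>complex\<close>. The constructors \<open>Ub\<close>, \<open>Fb\<close>, \<open>Db\<close> are the
  barred steps.\<close>

datatype step = U | F | D | Ub | Fb | Db

definition centers :: "complex set" where
  "centers = {Complex (2 + 4 * of_int i + 2 * of_int j) (2 * sqrt 3 * of_int j) | i j :: int. True}"

definition quarter_plane :: "complex set" where
  "quarter_plane = {z. Re z \<ge> 0 \<and> Im z \<ge> 0}"

fun start_angle :: "step \<Rightarrow> real" where
  "start_angle U = pi"
| "start_angle F = 2 * pi / 3"
| "start_angle D = pi / 3"
| "start_angle Ub = 5 * pi / 3"
| "start_angle Fb = 4 * pi / 3"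
| "start_angle Db = pi"

fun end_angle :: "step \<Rightarrow> real" where
  "end_angle U = 2 * pi / 3"
| "end_angle F = pi / 3"
| "end_angle D = 0"
| "end_angle Ub = 2 * pi"
| "end_angle Fb = 5 * pi / 3"
| "end_angle Db = 4 * pi / 3"

definition step_arc :: "complex \<Rightarrow> step \<Rightarrow> real \<Rightarrow> complex" where
  "step_arc c s = part_circlepath c 2 (start_angle s) (end_angle s)"

text \<open>\<open>packing_walk p w q\<close>: the word \<open>w\<close> is traced from \<open>p\<close> to \<open>q\<close> along arcs of circles of the
  packing, inside the quarter plane. The circle carrying each arc is determined by the starting
  point of the arc and the type of the step, so a walk is determined by \<open>p\<close> and \<open>w\<close>.\<close>

inductive packing_walk :: "complex \<Rightarrow> step list \<Rightarrow> complex \<Rightarrow> bool" where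
  Nil: "packing_walk p [] p"
| Cons: "c \<in> centers \<Longrightarrow> path_image (step_arc c s) \<subseteq> quarter_plane \<Longrightarrow>
    packing_walk (pathfinish (step_arc c s)) w q \<Longrightarrow>
    packing_walk (pathstart (step_arc c s)) (s # w) q"

definition packing_paths :: "step list set" where
  "packing_paths = {w. \<exists>q. packing_walk 0 w q \<and> Im q = 0}"


section \<open>The quarter-plane paths\<close>

datatype qstep = up | down | flat

fun displacement :: "qstep \<Rightarrow> int \<times> int" where
  "displacement up = (1, 1)"
| "displacement down = (1, -1)"
| "displacement flat = (1, 0)"

definition position :: "qstep list \<Rightarrow> int \<times> int" where
  "position w = (\<Sum>s\<leftarrow>w. displacement s)"

definition Q_paths :: "qstep list set" where
  "Q_paths = {w.
     (\<forall>n\<le>length w. fst (position (take n w)) \<ge> 0 \<and> snd (position (take n w)) \<ge> 0) \<and>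
     snd (position w) = 0 \<and>
     (\<forall>i<length w. w ! i = down \<longrightarrow> i + 1 < length w \<and> w ! (i + 1) = flat) \<and>
     (\<forall>i<length w. w ! i = flat \<longrightarrow> i > 0 \<and> (w ! (i - 1) = down \<or> w ! (i - 1) = flat))}"


section \<open>The recursive equations for the map\<close>

definition wpow :: "'a list \<Rightarrow> nat \<Rightarrow> 'a list" where
  "wpow w k = concat (replicate k w)"

definition g_recursion :: "(step list \<Rightarrow> qstep list) \<Rightarrow> bool" where
  "g_recursion g \<longleftrightarrow>
     g [] = [] \<and>
     (\<forall>P\<in>packing_paths.
       (\<forall>k. \<forall>Q\<in>packing_paths. \<forall>R\<in>packing_paths.
          P = [U] @ wpow [F, Fb] k @ [Ub] @ Q @ [Db, D] @ R \<longrightarrow>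
          g P = [up] @ g Q @ [down] @ [flat, flat] @ wpow [flat, flat] k @ g R) \<and>
       (\<forall>k S. \<forall>Q\<in>packing_paths. [U] @ S \<in> packing_paths \<longrightarrow>
          P = [U] @ wpow [F, Fb] k @ [Ub] @ Q @ [Db, Fb] @ S \<longrightarrow>
          g P = [up] @ g Q @ [down] @ [flat] @ wpow [flat, flat] k @ g ([U] @ S)) \<and>
       (\<forall>k. \<forall>R\<in>packing_paths.
          P = [U, F] @ wpow [Fb, F] k @ [D] @ R \<longrightarrow>
          g P = [up] @ g R @ [down] @ [flat] @ wpow [flat, flat] k))"


section \<open>Packing paths as words\<close>

fun can_follow :: "step \<Rightarrow> step \<Rightarrow> bool" where
  "can_follow U t \<longleftrightarrow> t \<in> {F, Ub}"
| "can_follow Fb t \<longleftrightarrow> t \<in> {F, Ub}"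
| "can_follow F t \<longleftrightarrow> t \<in> {Fb, D}"
| "can_follow Db t \<longleftrightarrow> t \<in> {Fb, D}"
| "can_follow Ub t \<longleftrightarrow> t \<in> {U, Db}"
| "can_follow D t \<longleftrightarrow> t \<in> {U, Db}"

text \<open>Points are written \<open>(a, sqrt 3 * b)\<close>; \<open>dx\<close>, \<open>dy\<close> is the displacement of a step and
  \<open>cx\<close>, \<open>cy\<close> the offset from its starting point to the center of its circle.\<close>

definition pt :: "int \<Rightarrow> int \<Rightarrow> complex" where
  "pt a b = Complex (of_int a) (sqrt 3 * of_int b)"

fun dx :: "step \<Rightarrow> int" where
  "dx U = 1" | "dx F = 2" | "dx D = 1" | "dx Ub = 1" | "dx Fb = 2" | "dx Db = 1"

fun dy :: "step \<Rightarrow> int" where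
  "dy U = 1" | "dy F = 0" | "dy D = -1" | "dy Ub = 1" | "dy Fb = 0" | "dy Db = -1"

fun cx :: "step \<Rightarrow> int" where
  "cx U = 2" | "cx F = 1" | "cx D = -1" | "cx Ub = -1" | "cx Fb = 1" | "cx Db = 2"

fun cy :: "step \<Rightarrow> int" where
  "cy U = 0" | "cy F = -1" | "cy D = -1" | "cy Ub = 1" | "cy Fb = 1" | "cy Db = 0"

definition step_ok :: "step \<Rightarrow> int \<Rightarrow> int \<Rightarrow> bool" where
  "step_ok s a b \<longleftrightarrow> even (b + cy s) \<and> 4 dvd (a + cx s - 2 - (b + cy s))"

definition height :: "step list \<Rightarrow> int" where
  "height w = (\<Sum>s\<leftarrow>w. dy s)"

lemma pt_eq_iff [simp]: "pt a b = pt a' b' \<longleftrightarrow> a = a' \<and> b = b'"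
  by (auto simp: pt_def)

lemma pt_in_centers_iff: "pt a b \<in> centers \<longleftrightarrow> even b \<and> 4 dvd (a - 2 - b)"
proof
  assume "pt a b \<in> centers"
  then obtain i j :: int where ij: "real_of_int a = 2 + 4 * of_int i + 2 * of_int j"
    "sqrt 3 * real_of_int b = 2 * sqrt 3 * of_int j"
    by (auto simp: centers_def pt_def)
  from ij(1) have "real_of_int a = real_of_int (2 + 4 * i + 2 * j)" by simp
  then have a: "a = 2 + 4 * i + 2 * j" by linarith
  from ij(2) have "sqrt 3 * real_of_int b = sqrt 3 * real_of_int (2 * j)" by simp
  then have b: "b = 2 * j"
    by (metis mult_left_cancel of_int_eq_iff real_sqrt_eq_zero_cancel_iff zero_neq_numeral)
  show "even b \<and> 4 dvd (a - 2 - b)" unfolding a b by simp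
next
  assume "even b \<and> 4 dvd (a - 2 - b)"
  then obtain i j where "b = 2 * j" "a - 2 - b = 4 * i" by (auto elim!: dvdE)
  then have "a = 2 + 4 * i + 2 * j" "b = 2 * j" by auto
  then show "pt a b \<in> centers" by (auto simp: centers_def pt_def)
qed

lemma cos_sin_angles:
  "cos (2 * pi / 3) = -1/2" "sin (2 * pi / 3) = sqrt 3 / 2"
  "cos (4 * pi / 3) = -1/2" "sin (4 * pi / 3) = - sqrt 3 / 2"
  "cos (5 * pi / 3) = 1/2" "sin (5 * pi / 3) = - sqrt 3 / 2"
proof -
  have e: "2 * pi / 3 = pi - pi / 3" "4 * pi / 3 = pi / 3 + pi" "5 * pi / 3 = 2 * pi - pi / 3"
    by simp_all
  show "cos (2 * pi / 3) = -1/2" "sin (2 * pi / 3) = sqrt 3 / 2"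
    unfolding e(1) cos_pi_minus sin_pi_minus by (simp_all add: cos_60 sin_60)
  show "cos (4 * pi / 3) = -1/2" "sin (4 * pi / 3) = - sqrt 3 / 2"
    unfolding e(2) cos_periodic_pi sin_periodic_pi by (simp_all add: cos_60 sin_60)
  show "cos (5 * pi / 3) = 1/2" "sin (5 * pi / 3) = - sqrt 3 / 2"
    unfolding e(3) cos_2pi_minus sin_2pi_minus by (simp_all add: cos_60 sin_60)
qed

lemma pathstart_step_arc: "pathstart (step_arc c s) = c - pt (cx s) (cy s)"
proof -
  have "pathstart (step_arc c s) = c + of_real 2 * cis (start_angle s)"
    unfolding step_arc_def pathstart_part_circlepath cis_conv_exp ..
  then show ?thesis
    by (cases s) (simp_all add: complex_eq_iff pt_def cos_60 sin_60 cos_sin_angles)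
qed

lemma pathfinish_step_arc: "pathfinish (step_arc c s) = c - pt (cx s) (cy s) + pt (dx s) (dy s)"
proof -
  have "pathfinish (step_arc c s) = c + of_real 2 * cis (end_angle s)"
    unfolding step_arc_def pathfinish_part_circlepath cis_conv_exp ..
  then show ?thesis
    by (cases s) (simp_all add: complex_eq_iff pt_def cos_60 sin_60 cos_sin_angles)
qed

fun lowest :: "step \<Rightarrow> real" where
  "lowest U = 0" | "lowest F = 0" | "lowest D = 0"
| "lowest Ub = - sqrt 3" | "lowest Fb = -2" | "lowest Db = - sqrt 3"

lemma cos_sin_bounds:
  assumes "t \<in> closed_segment (start_angle s) (end_angle s)"
  shows "2 * cos t \<ge> - of_int (cx s) \<and> 2 * sin t \<ge> lowest s"
proof -
  have ang: "cos x \<ge> 1/2 \<and> sin x \<le> sqrt 3 / 2 \<and> sin x \<ge> 0" if "0 \<le> x" "x \<le> pi/3" for x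
    using cos_monotone_0_pi_le[of x "pi/3"] sin_monotone_2pi_le[of x "pi/3"] sin_ge_zero[of x]
      that by (simp add: cos_60 sin_60)
  have mid: "cos x \<le> 1/2 \<and> cos x \<ge> -1/2 \<and> sin x \<ge> 0" if "pi/3 \<le> x" "x \<le> 2*pi/3" for x
    using cos_monotone_0_pi_le[of x "2*pi/3"] cos_monotone_0_pi_le[of "pi/3" x] sin_ge_zero[of x]
      that by (simp add: cos_60 cos_sin_angles)
  have r1: "cos (2*pi - t) = cos t" "sin (2*pi - t) = - sin t" by (simp_all add: cos_diff sin_diff)
  have r2: "cos (t - pi) = - cos t" "sin (t - pi) = - sin t" by (simp_all add: cos_diff sin_diff)
  show ?thesis
  proof (cases s)
    case U
    with assms have "2*pi/3 \<le> t" "t \<le> pi" by (auto simp: closed_segment_eq_real_ivl)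
    then show ?thesis using U sin_ge_zero[of t] by simp
  next
    case F
    with assms have "pi/3 \<le> t" "t \<le> 2*pi/3" by (auto simp: closed_segment_eq_real_ivl)
    then show ?thesis using F mid[of t] by simp
  next
    case D
    with assms have "0 \<le> t" "t \<le> pi/3"
      by (auto simp: closed_segment_eq_real_ivl less_imp_le not_le split: if_splits)
    then show ?thesis using D ang[of t] by simp
  next
    case Ub
    with assms have "5*pi/3 \<le> t" "t \<le> 2*pi" by (auto simp: closed_segment_eq_real_ivl)
    then show ?thesis using Ub ang[of "2*pi - t"] unfolding r1 by simp
  next
    case Fb
    with assms have "4*pi/3 \<le> t" "t \<le> 5*pi/3" by (auto simp: closed_segment_eq_real_ivl)
    then show ?thesis using Fb mid[of "t - pi"] unfolding r2 by simp
  next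
    case Db
    with assms have "pi \<le> t" "t \<le> 4*pi/3" by (auto simp: closed_segment_eq_real_ivl)
    then show ?thesis using Db ang[of "t - pi"] unfolding r2 by simp
  qed
qed

lemma step_arc_in_quarter_plane:
  assumes "a \<ge> 0" "b \<ge> 0" "b + dy s \<ge> 0" "step_ok s a b"
  shows "path_image (step_arc (pt (a + cx s) (b + cy s)) s) \<subseteq> quarter_plane"
proof
  fix z assume "z \<in> path_image (step_arc (pt (a + cx s) (b + cy s)) s)"
  then obtain t where t: "t \<in> closed_segment (start_angle s) (end_angle s)"
    and z: "z = pt (a + cx s) (b + cy s) + of_real 2 * cis t"
    by (auto simp: step_arc_def path_image_part_circlepath')
  have "Re z \<ge> 0"
    using cos_sin_bounds[OF t] assms(1) by (simp add: z pt_def)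
  moreover have "sqrt 3 * of_int (b + cy s) + lowest s \<ge> 0"
  proof (cases s)
    case F
    with assms have "odd b" by (simp add: step_ok_def)
    with assms(2) have "b \<ge> 1" by presburger
    then show ?thesis using F by simp
  next
    case Fb
    with assms have "odd b" by (simp add: step_ok_def)
    with assms(2) have "b + 1 \<ge> 2" by presburger
    then have "sqrt 3 * real_of_int (b + 1) \<ge> 1 * 2"
      by (intro mult_mono) auto
    then show ?thesis using Fb by simp
  next
    case Db
    then have "sqrt 3 * real_of_int (b - 1) \<ge> 0" using assms(3) by simp
    then show ?thesis using Db by (simp add: algebra_simps)
  qed (use assms in \<open>auto simp: algebra_simps\<close>)
  then have "Im z \<ge> 0"
    using cos_sin_bounds[OF t] by (simp add: z pt_def)
  ultimately show "z \<in> quarter_plane" by (simp add: quarter_plane_def)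
qed

lemma pt_add: "pt a b + pt a' b' = pt (a + a') (b + b')"
  and pt_diff: "pt a b - pt a' b' = pt (a - a') (b - b')"
  by (simp_all add: pt_def complex_eq_iff algebra_simps)

lemma packing_walk_Nil_iff: "packing_walk p [] q \<longleftrightarrow> q = p"
  by (auto elim: packing_walk.cases intro: packing_walk.intros)

lemma packing_walk_Cons_iff:
  assumes "a \<ge> 0" "b \<ge> 0"
  shows "packing_walk (pt a b) (s # w) q \<longleftrightarrow>
    step_ok s a b \<and> b + dy s \<ge> 0 \<and> packing_walk (pt (a + dx s) (b + dy s)) w q"
proof
  assume "packing_walk (pt a b) (s # w) q"
  then obtain c where c: "c \<in> centers" "path_image (step_arc c s) \<subseteq> quarter_plane"
    "packing_walk (pathfinish (step_arc c s)) w q" "pt a b = pathstart (step_arc c s)"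
    by (auto elim: packing_walk.cases)
  have c_eq: "c = pt (a + cx s) (b + cy s)"
    using c(4) by (simp add: pathstart_step_arc flip: pt_add)
  have fin: "pathfinish (step_arc c s) = pt (a + dx s) (b + dy s)"
    by (simp add: pathfinish_step_arc c_eq pt_add pt_diff)
  have "pt (a + dx s) (b + dy s) \<in> quarter_plane"
    using c(2) pathfinish_in_path_image[of "step_arc c s"] unfolding fin by blast
  then have "b + dy s \<ge> 0"
    unfolding quarter_plane_def pt_def by (simp add: zero_le_mult_iff del: of_int_add)
  moreover have "step_ok s a b"
    using c(1) unfolding c_eq pt_in_centers_iff step_ok_def by simp
  ultimately show "step_ok s a b \<and> b + dy s \<ge> 0 \<and> packing_walk (pt (a + dx s) (b + dy s)) w q"
    using c(3) fin by simp
next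
  assume r: "step_ok s a b \<and> b + dy s \<ge> 0 \<and> packing_walk (pt (a + dx s) (b + dy s)) w q"
  let ?c = "pt (a + cx s) (b + cy s)"
  have "?c \<in> centers" using r by (simp add: pt_in_centers_iff step_ok_def)
  moreover have "path_image (step_arc ?c s) \<subseteq> quarter_plane"
    using step_arc_in_quarter_plane assms r by simp
  moreover have "pathfinish (step_arc ?c s) = pt (a + dx s) (b + dy s)"
    by (simp add: pathfinish_step_arc pt_add pt_diff)
  moreover have "pathstart (step_arc ?c s) = pt a b"
    by (simp add: pathstart_step_arc pt_diff)
  ultimately show "packing_walk (pt a b) (s # w) q"
    using packing_walk.Cons[of ?c s w q] r by simp
qed

lemma step_ok_iff:
  "step_ok s a b \<longleftrightarrow> (even b \<longleftrightarrow> s \<in> {U, Db}) \<and> (a - b) mod 4 = (if s \<in> {D, Fb} then 2 else 0)"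
proof -
  have "4 dvd m - 2 \<longleftrightarrow> m mod 4 = 2" "4 dvd m - 4 \<longleftrightarrow> m mod 4 = 0" "4 dvd m \<longleftrightarrow> m mod 4 = 0"
    for m :: int by presburger+
  from this[of "a - b"] show ?thesis
    by (cases s) (simp_all add: step_ok_def algebra_simps)
qed

lemma step_ok_next:
  assumes "step_ok s a b"
  shows "step_ok t (a + dx s) (b + dy s) \<longleftrightarrow> can_follow s t"
proof -
  have shift: "(m + 2) mod 4 = (if m mod 4 = 2 then 0 else 2)" if "m mod 4 \<in> {0, 2}" for m :: int
    using that by (auto simp: mod_add_eq[symmetric, of m])
  have eq: "a + dx s - (b + dy s) = (a - b) + (if s \<in> {U, Ub} then 0 else 2)"
    by (cases s) simp_all
  have par: "even (b + dy s) \<longleftrightarrow> (if s \<in> {F, Fb} then even b else odd b)"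
    by (cases s) simp_all
  show ?thesis
    using assms shift[of "a - b"] unfolding step_ok_iff eq par
    by (cases s; cases t) simp_all
qed

lemma prefix_heights_Cons:
  "(\<forall>n\<le>length (s # w). 0 \<le> b + height (take n (s # w))) \<longleftrightarrow>
   0 \<le> b \<and> (\<forall>n\<le>length w. 0 \<le> b + dy s + height (take n w))"
proof -
  have "(\<forall>n\<le>Suc m. P n) \<longleftrightarrow> P 0 \<and> (\<forall>n\<le>m. P (Suc n))" for P and m :: nat
    by (metis Suc_le_mono not0_implies_Suc zero_le)
  then show ?thesis by (simp add: height_def add.assoc)
qed

lemma packing_walk_iff:
  assumes "a \<ge> 0" "b \<ge> 0"
  shows "(\<exists>q. packing_walk (pt a b) w q \<and> Im q = 0) \<longleftrightarrow>
    (w \<noteq> [] \<longrightarrow> step_ok (hd w) a b) \<and> successively can_follow w \<and>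
    (\<forall>n\<le>length w. 0 \<le> b + height (take n w)) \<and> b + height w = 0"
  using assms
proof (induction w arbitrary: a b)
  case Nil
  then show ?case by (simp add: packing_walk_Nil_iff height_def pt_def)
next
  case (Cons s w)
  show ?case
  proof (cases "step_ok s a b \<and> b + dy s \<ge> 0")
    case True
    moreover have "a + dx s \<ge> 0" using Cons.prems by (cases s) auto
    ultimately show ?thesis
      using Cons.IH[of "a + dx s" "b + dy s"] Cons.prems step_ok_next[of s a b "hd w"]
      unfolding prefix_heights_Cons packing_walk_Cons_iff[OF Cons.prems] successively_Cons
      by (auto simp: height_def add.assoc)
  next
    case False
    have "\<not> (\<forall>n\<le>length (s # w). 0 \<le> b + height (take n (s # w)))" if "b + dy s < 0"
      unfolding prefix_heights_Cons using that by (force simp: height_def)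
    then show ?thesis
      using False unfolding packing_walk_Cons_iff[OF Cons.prems] not_le[symmetric] list.sel by blast
  qed
qed

theorem packing_paths_eq_words:
  "packing_paths = {w. (w \<noteq> [] \<longrightarrow> hd w = U) \<and> successively can_follow w \<and>
     (\<forall>n\<le>length w. height (take n w) \<ge> 0) \<and> height w = 0}"
proof -
  have "step_ok s 0 0 \<longleftrightarrow> s = U \<or> s = Db" for s
    by (cases s) (simp_all add: step_ok_def)
  moreover have "hd w \<noteq> Db" if "w \<noteq> []" "\<forall>n\<le>length w. height (take n w) \<ge> 0" for w
    using that by (cases w) (auto simp: height_def dest: spec[of _ 1])
  moreover have "(0 :: complex) = pt 0 0" by (simp add: pt_def complex_eq_iff)
  ultimately show ?thesis
    unfolding packing_paths_def using packing_walk_iff[of 0 0] by auto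
qed

end

theory Submission
  imports Defs
begin

text \<open>Both families have an unambiguous first-passage decomposition. Since a packing word
  alternates between even and odd heights in a way dictated by \<^const>\<open>can_follow\<close>, a nonempty
  packing path factors in exactly one of the three ways in the definition of \<open>g\<close>. A nonempty path
  in \<^const>\<open>Q_paths\<close> factors uniquely as \<open>u X d f\<^sup>j Y\<close> with \<open>j \<ge> 1\<close>, and the three cases correspond to
  \<open>j\<close> even, \<open>j\<close> odd with \<open>Y\<close> nonempty, and \<open>j\<close> odd with \<open>Y\<close> empty. The graph of \<open>g\<close> is therefore a
  one-to-one correspondence, generated inductively.\<close>

section \<open>First-passage decompositions\<close>

text \<open>Walks starting at height \<open>h\<close> that stay nonnegative and end at height \<open>0\<close>; the starting height
  itself is not checked.\<close>

fun excursion :: "('a \<Rightarrow> int) \<Rightarrow> int \<Rightarrow> 'a list \<Rightarrow> bool" where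
  "excursion wt h [] \<longleftrightarrow> h = 0"
| "excursion wt h (x # w) \<longleftrightarrow> h + wt x \<ge> 0 \<and> excursion wt (h + wt x) w"

text \<open>The hypothesis \<open>h \<ge> 0\<close> supplies the empty prefix, which
  \<open>excursion\<close> leaves unchecked.\<close>

lemma excursion_iff_prefixes:
  assumes "h \<ge> 0"
  shows "excursion wt h w \<longleftrightarrow>
    (\<forall>n\<le>length w. 0 \<le> h + (\<Sum>x\<leftarrow>take n w. wt x)) \<and> h + (\<Sum>x\<leftarrow>w. wt x) = 0"
  using assms
proof (induction w arbitrary: h)
  case Nil
  then show ?case by simp
next
  case (Cons x w)
  have "(\<forall>n\<le>Suc m. P n) \<longleftrightarrow> P 0 \<and> (\<forall>n\<le>m. P (Suc n))" for P and m :: nat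
    by (metis Suc_le_mono not0_implies_Suc zero_le)
  then have split: "(\<forall>n\<le>length (x # w). 0 \<le> h + (\<Sum>x\<leftarrow>take n (x # w). wt x)) \<longleftrightarrow>
    0 \<le> h \<and> (\<forall>n\<le>length w. 0 \<le> h + wt x + (\<Sum>x\<leftarrow>take n w. wt x))"
    by (simp add: add.assoc)
  show ?case
  proof (cases "h + wt x \<ge> 0")
    case True
    then show ?thesis using Cons.IH[of "h + wt x"] Cons.prems unfolding split by (simp add: add.assoc)
  next
    case False
    then have "\<not> (\<forall>n\<le>length w. 0 \<le> h + wt x + (\<Sum>x\<leftarrow>take n w. wt x))"
      by (auto intro!: exI[of _ 0])
    then show ?thesis using False unfolding split by simp
  qed
qed

lemma excursion_sum_list: "excursion wt h w \<Longrightarrow> (\<Sum>x\<leftarrow>w. wt x) = - h"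
  by (induction w arbitrary: h) fastforce+

text \<open>Lifting \<open>v\<close> by \<open>b \<ge> 0\<close> keeps it nonnegative and makes it
  end at height \<open>b\<close>, where \<open>w\<close> takes over.\<close>

lemma excursion_append:
  "excursion wt a v \<Longrightarrow> excursion wt b w \<Longrightarrow> b \<ge> 0 \<Longrightarrow> excursion wt (a + b) (v @ w)"
proof (induction v arbitrary: a)
  case (Cons x v)
  then show ?case using Cons.IH[of "a + wt x"] by (simp add: algebra_simps)
qed simp

text \<open>No step drops by more than one, so level \<open>h\<close> cannot be skipped on the way
  to 0. The step \<open>x\<close> is the first arrival at \<open>h\<close>, coming from
  \<open>h + 1\<close>; the part \<open>v\<close> before it stays at or above
  \<open>h + 1\<close>.\<close>

lemma first_passage_exists:
  assumes "excursion wt (a + 1 + h) w" "a \<ge> 0" "h \<ge> 0" "\<And>x. wt x \<ge> -1"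
  obtains v x u where "w = v @ x # u" "excursion wt a v" "wt x = -1" "excursion wt h u"
  using assms(1,2)
proof (induction w arbitrary: a thesis)
  case Nil
  then show ?case using assms(3) by simp
next
  case (Cons y w)
  show ?case
  proof (cases "a + wt y \<ge> 0")
    case True
    have "excursion wt (a + wt y + 1 + h) w" using Cons.prems(2) by (simp add: algebra_simps)
    then obtain v x u where "w = v @ x # u" "excursion wt (a + wt y) v" "wt x = -1" "excursion wt h u"
      using Cons.IH True by blast
    then show ?thesis using Cons.prems(1)[of "y # v" x u] True by simp
  next
    case False
    then have "a = 0" "wt y = -1" using Cons.prems(3) assms(4)[of y] by linarith+
    then show ?thesis using Cons.prems(1)[of "[]" y w] Cons.prems(2) by simp
  qed
qed

text \<open>If \<open>v\<close> were shorter than \<open>v'\<close>, then \<open>v'\<close> would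
  contain \<open>v\<close> followed by \<open>x\<close> and reach height -1; the other order is
  symmetric.\<close>

lemma first_passage_unique:
  assumes "v @ x # u = v' @ x' # u'" "excursion wt a v" "excursion wt a v'" "wt x = -1" "wt x' = -1"
  shows "v = v' \<and> x = x' \<and> u = u'"
  using assms
proof (induction v arbitrary: a v')
  case Nil
  then show ?case by (cases v') auto
next
  case (Cons y v)
  then show ?case by (cases v') auto
qed


section \<open>Packing paths\<close>

lemma height_Nil [simp]: "height [] = 0"
  and height_Cons [simp]: "height (s # w) = dy s + height w"
  and height_append [simp]: "height (v @ w) = height v + height w"
  by (simp_all add: height_def)

lemma dy_ge: "dy s \<ge> -1"
  by (cases s) auto

text \<open>Prefixing \<^const>\<open>D\<close> forces the first step to be \<^const>\<open>U\<close> or \<^const>\<open>Db\<close>, and \<^const>\<open>Db\<close> would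
  lead below the axis.\<close>

lemma packing_paths_iff:
  "w \<in> packing_paths \<longleftrightarrow> successively can_follow (D # w) \<and> excursion dy 0 w"
proof -
  have "excursion dy 0 w \<Longrightarrow> hd w = U \<longleftrightarrow> can_follow D (hd w)" if "w \<noteq> []"
    using that by (cases w; cases "hd w") auto
  then show ?thesis
    unfolding packing_paths_eq_words successively_Cons
    using excursion_iff_prefixes[of 0 dy w] by (auto simp: height_def)
qed

lemma Nil_in_packing_paths: "[] \<in> packing_paths"
  by (simp add: packing_paths_iff)

lemma packing_path_nonempty:
  assumes "w \<in> packing_paths" "w \<noteq> []"
  obtains v where "w = U # v"
  using assms unfolding packing_paths_eq_words by (cases w) auto

text \<open>\<open>U\<close> and \<open>Db\<close> leave from even heights, the other steps from odd
  ones, and only \<open>F\<close> and \<open>Fb\<close> keep the parity. The sentinel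
  \<open>D\<close> makes the empty word fit the pattern.\<close>

lemma even_height_iff_last:
  "successively can_follow (D # w) \<Longrightarrow> last (D # w) \<in> {Ub, D} \<longleftrightarrow> even (height w)"
proof (induction w rule: rev_induct)
  case (snoc s w)
  from snoc.prems have 1: "successively can_follow (D # w)" and 2: "can_follow (last (D # w)) s"
    using successively_append_iff[of can_follow "D # w" "[s]"] by auto
  from snoc.IH[OF 1] 2 show ?case
    by (cases "last (D # w)"; cases s) (simp_all split: if_splits)
qed simp

lemma packing_path_last:
  assumes "w \<in> packing_paths"
  shows "last (D # w) \<in> {Ub, D}"
  using assms even_height_iff_last[of w] excursion_sum_list[of dy 0 w]
  by (simp add: packing_paths_iff height_def)

text \<open>A packing path fits between \<open>Ub\<close> and \<open>Db\<close> without further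
  conditions: if nonempty it begins with \<open>U\<close>, which may follow \<open>Ub\<close>, and
  it ends with \<open>Ub\<close> or \<open>D\<close>, either of which admits
  \<open>Db\<close>.\<close>

lemma successively_packing_path_Db:
  assumes "w \<in> packing_paths"
  shows "successively can_follow (Ub # w @ Db # v) \<longleftrightarrow> successively can_follow (Db # v)"
proof -
  have "successively can_follow (w @ Db # v) \<longleftrightarrow> successively can_follow (Db # v)"
    using assms packing_path_last[OF assms]
    by (auto simp: packing_paths_iff successively_append_iff successively_Cons split: if_splits)
  moreover have "can_follow Ub (hd (w @ Db # v))"
    using assms by (cases w) (auto simp: packing_paths_eq_words)
  ultimately show ?thesis by (simp add: successively_Cons)
qed

section \<open>Runs of alternating \<open>F\<close> and \<open>Fb\<close>\<close>

lemma wpow_0 [simp]: "wpow w 0 = []"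
  and wpow_Suc [simp]: "wpow w (Suc k) = w @ wpow w k"
  by (simp_all add: wpow_def)

text \<open>Rewrites the third case of the recursion so that all three cases share the prefix
  \<open>U # wpow [F, Fb] k\<close>.\<close>

lemma wpow_rotate: "F # wpow [Fb, F] k @ w = wpow [F, Fb] k @ F # w"
  by (induction k) auto

lemma wpow_flat: "wpow [flat, flat] k = replicate (2 * k) flat"
  by (induction k) auto

lemma successively_wpow:
  "x \<in> {U, Fb} \<Longrightarrow> successively can_follow (x # wpow [F, Fb] k @ w) \<longleftrightarrow> successively can_follow (U # w)"
proof (induction k arbitrary: x)
  case 0
  then show ?case by (cases w) auto
next
  case (Suc k)
  have "successively can_follow (Fb # wpow [F, Fb] k @ w) \<longleftrightarrow> successively can_follow (U # w)"
    by (rule Suc.IH) simp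
  then show ?case using Suc.prems by auto
qed

lemma excursion_wpow [simp]:
  "h \<ge> 0 \<Longrightarrow> excursion dy h (wpow [F, Fb] k @ w) \<longleftrightarrow> excursion dy h w"
  by (induction k) auto

text \<open>This and the next two lemmas make the run uniquely readable: a further block begins
  \<open>F Fb\<close>, whereas the run is terminated by \<open>Ub\<close> or by
  \<open>F D\<close>.\<close>

lemma wpow_Ub_eq_iff [simp]:
  "wpow [F, Fb] k @ Ub # v = wpow [F, Fb] l @ Ub # w \<longleftrightarrow> k = l \<and> v = w"
proof (induction k arbitrary: l)
  case 0
  then show ?case by (cases l) auto
next
  case (Suc k)
  then show ?case by (cases l) auto
qed

lemma wpow_FD_eq_iff [simp]:
  "wpow [F, Fb] k @ F # D # v = wpow [F, Fb] l @ F # D # w \<longleftrightarrow> k = l \<and> v = w"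
proof (induction k arbitrary: l)
  case 0
  then show ?case by (cases l) auto
next
  case (Suc k)
  then show ?case by (cases l) auto
qed

lemma wpow_Ub_neq_FD [simp]:
  "wpow [F, Fb] k @ Ub # v \<noteq> wpow [F, Fb] l @ F # D # w"
  "wpow [F, Fb] l @ F # D # w \<noteq> wpow [F, Fb] k @ Ub # v"
proof -
  show "wpow [F, Fb] k @ Ub # v \<noteq> wpow [F, Fb] l @ F # D # w"
  proof (induction k arbitrary: l)
    case 0
    then show ?case by (cases l) auto
  next
    case (Suc k)
    then show ?case by (cases l) auto
  qed
  then show "wpow [F, Fb] l @ F # D # w \<noteq> wpow [F, Fb] k @ Ub # v" by metis
qed

lemma packing_path_Db_eq_iff:
  assumes "v \<in> packing_paths" "v' \<in> packing_paths"
  shows "v @ Db # w = v' @ Db # w' \<longleftrightarrow> v = v' \<and> w = w'"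
  using first_passage_unique[of v Db w v' Db w' dy 0] assms by (auto simp: packing_paths_iff)

text \<open>After \<open>U\<close> or \<open>Fb\<close> only \<open>F\<close> or \<open>Ub\<close>
  is possible, after \<open>F\<close> only \<open>Fb\<close> or \<open>D\<close>. The run itself has
  height 0, so negative total height prevents the word from ending before a terminator
  appears.\<close>

lemma odd_run_cases:
  assumes "x \<in> {U, Fb}" "successively can_follow (x # w)" "height w < 0"
  obtains k v where "w = wpow [F, Fb] k @ Ub # v" | k v where "w = wpow [F, Fb] k @ F # D # v"
  using assms
proof (induction w arbitrary: x thesis rule: length_induct)
  case (1 w)
  note prems = 1(2-)
  from prems obtain y w' where w: "w = y # w'" by (cases w) auto
  with prems have y: "y \<in> {F, Ub}" by auto
  show ?case
  proof (cases "y = Ub")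
    case True
    then show ?thesis using prems(1)[of 0 w'] w by simp
  next
    case False
    with y w have F: "w = F # w'" by simp
    with prems obtain z w'' where w': "w' = z # w''" by (cases w') auto
    with prems F have z: "z \<in> {Fb, D}" by auto
    show ?thesis
    proof (cases "z = D")
      case True
      then show ?thesis using prems(2)[of 0 w''] F w' by simp
    next
      case False
      with z w' F have w: "w = F # Fb # w''" by simp
      \<comment> \<open>One block \<open>F Fb\<close> is removed: \<open>w''\<close> has the same
        height as \<open>w\<close>, and its predecessor is now \<open>Fb\<close>.\<close>
      have "\<exists>k v. w'' = wpow [F, Fb] k @ Ub # v \<or> w'' = wpow [F, Fb] k @ F # D # v"
        using 1(1)[rule_format, of w'' _ Fb] prems w by fastforce
      then obtain k v where "w'' = wpow [F, Fb] k @ Ub # v \<or> w'' = wpow [F, Fb] k @ F # D # v"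
        by blast
      then show ?thesis using prems(1)[of "Suc k" v] prems(2)[of "Suc k" v] w by auto
    qed
  qed
qed

section \<open>The three factorizations of a nonempty packing path\<close>

lemma packing_path_case1:
  assumes "v \<in> packing_paths" "w \<in> packing_paths"
  shows "U # wpow [F, Fb] k @ Ub # v @ Db # D # w \<in> packing_paths"
proof -
  \<comment> \<open>\<open>U\<close> and \<open>Ub\<close> climb to height 2, where the lifted
    excursion \<open>v\<close> takes place.\<close>
  have "excursion dy (0 + 2) (v @ Db # D # w)"
    by (rule excursion_append) (use assms in \<open>simp_all add: packing_paths_iff\<close>)
  then have "excursion dy 0 (U # wpow [F, Fb] k @ Ub # v @ Db # D # w)"
    by simp
  moreover have "successively can_follow (Db # D # w)"
    using assms(2) by (simp add: packing_paths_iff)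
  then have "successively can_follow (D # U # wpow [F, Fb] k @ Ub # v @ Db # D # w)"
    by (simp add: successively_wpow successively_packing_path_Db[OF assms(1)])
  ultimately show ?thesis unfolding packing_paths_iff by blast
qed

text \<open>After \<open>Db\<close>, \<open>Fb\<close> the height is 1 and the possible
  continuations are those after \<open>U\<close>, so \<open>w\<close> finishes this word just as it
  finishes \<open>U # w\<close>.\<close>

lemma packing_path_case2:
  assumes "v \<in> packing_paths" "U # w \<in> packing_paths"
  shows "U # wpow [F, Fb] k @ Ub # v @ Db # Fb # w \<in> packing_paths"
proof -
  have "excursion dy (0 + 2) (v @ Db # Fb # w)"
    by (rule excursion_append) (use assms in \<open>simp_all add: packing_paths_iff\<close>)
  then have "excursion dy 0 (U # wpow [F, Fb] k @ Ub # v @ Db # Fb # w)"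
    by simp
  moreover have "successively can_follow (Db # Fb # w)"
    using assms(2) by (cases w) (auto simp: packing_paths_iff)
  then have "successively can_follow (D # U # wpow [F, Fb] k @ Ub # v @ Db # Fb # w)"
    by (simp add: successively_wpow successively_packing_path_Db[OF assms(1)])
  ultimately show ?thesis unfolding packing_paths_iff by blast
qed

lemma packing_path_case3:
  assumes "w \<in> packing_paths"
  shows "U # wpow [F, Fb] k @ F # D # w \<in> packing_paths"
  using assms by (simp add: packing_paths_iff successively_wpow)

text \<open>The run at height 1 ends either with \<open>F D\<close>, which returns to the axis, or
  with \<open>Ub\<close>, which leads to height 2. In the latter situation the first passage from 2
  to 1 cuts off \<open>v\<close>, and the step after it separates the first two cases.\<close>

lemma packing_path_cases:
  assumes "p \<in> packing_paths"
  obtains (empty) "p = []"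
  | (case1) k v w where "p = U # wpow [F, Fb] k @ Ub # v @ Db # D # w"
      "v \<in> packing_paths" "w \<in> packing_paths"
  | (case2) k v w where "p = U # wpow [F, Fb] k @ Ub # v @ Db # Fb # w"
      "v \<in> packing_paths" "U # w \<in> packing_paths"
  | (case3) k w where "p = U # wpow [F, Fb] k @ F # D # w" "w \<in> packing_paths"
proof (cases "p = []")
  case False
  then obtain t where t: "p = U # t" using assms packing_path_nonempty by blast
  from assms t have ch: "successively can_follow (U # t)" and ex: "excursion dy 1 t"
    by (auto simp: packing_paths_iff)
  have "height t < 0" using excursion_sum_list[OF ex] by (simp add: height_def)
  then show ?thesis using ch
  proof (cases rule: odd_run_cases[of U t, rotated 1, case_names suc neg Ub FD])
    case (Ub k r)
    with ch have chr: "successively can_follow (Ub # r)"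
      using successively_wpow[of U k "Ub # r"] by simp
    \<comment> \<open>Height 2 is split to obtain the first passage from level 2 to level 1.\<close>
    from Ub ex have "excursion dy (0 + 1 + 1) r" by simp
    then obtain v x u where r: "r = v @ x # u" and v: "excursion dy 0 v"
      and x: "dy x = -1" and u: "excursion dy 1 u"
      by (rule first_passage_exists) (auto simp: dy_ge)
    \<comment> \<open>\<open>Ub\<close> and \<open>D\<close> have the same successors, so the
      sentinel \<open>D\<close> can replace \<open>Ub\<close>.\<close>
    have Dr: "successively can_follow (D # v @ x # u)"
      using chr r by (cases v) auto
    then have Dv: "successively can_follow (D # v)" and lx: "can_follow (last (D # v)) x"
      and xu: "successively can_follow (x # u)"
      using successively_append_iff[of can_follow "D # v" "x # u"] by auto
    have vP: "v \<in> packing_paths" using Dv v by (simp add: packing_paths_iff)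
    \<comment> \<open>After \<open>Ub\<close> or \<open>D\<close> only \<open>U\<close> and
      \<open>Db\<close> are possible, and only \<open>Db\<close> descends.\<close>
    have "x = Db" using packing_path_last[OF vP] lx x by (cases x) auto
    with xu u obtain y w where y: "u = y # w" "y = D \<or> y = Fb" by (cases u) auto
    from y(2) show ?thesis
    proof
      assume "y = D"
      with xu u y \<open>x = Db\<close> have "w \<in> packing_paths" by (simp add: packing_paths_iff)
      then show ?thesis using case1 vP Ub t r y \<open>y = D\<close> \<open>x = Db\<close> by simp
    next
      assume "y = Fb"
      with xu u y \<open>x = Db\<close> have "U # w \<in> packing_paths"
        by (cases w) (auto simp: packing_paths_iff)
      then show ?thesis using case2 vP Ub t r y \<open>y = Fb\<close> \<open>x = Db\<close> by simp
    qed
  next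
    case (FD k r)
    then have "r \<in> packing_paths"
      using ch ex successively_wpow[of U k "F # D # r"] by (simp add: packing_paths_iff)
    then show ?thesis using case3 FD t by simp
  qed simp_all
qed (rule empty)


section \<open>The quarter-plane paths\<close>

definition rise :: "qstep \<Rightarrow> int" where
  "rise s = snd (displacement s)"

lemma rise_simps [simp]: "rise up = 1" "rise down = -1" "rise flat = 0"
  by (simp_all add: rise_def)

text \<open>Phrasing both local conditions as one relation on adjacent steps lets paths be cut and
  glued through \<open>successively\<close>.\<close>

definition qfollow :: "qstep \<Rightarrow> qstep \<Rightarrow> bool" where
  "qfollow s t \<longleftrightarrow> (s = down \<longrightarrow> t = flat) \<and> (t = flat \<longrightarrow> s \<noteq> up)"

lemma fst_position: "fst (position w) = int (length w)"
  and snd_position: "snd (position w) = (\<Sum>s\<leftarrow>w. rise s)"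
proof -
  have "fst (displacement s) = 1" for s by (cases s) auto
  then show "fst (position w) = int (length w)"
    by (induction w) (simp_all add: position_def)
  show "snd (position w) = (\<Sum>s\<leftarrow>w. rise s)"
    by (induction w) (simp_all add: position_def rise_def)
qed

text \<open>The two sentinel steps \<^const>\<open>up\<close> forbid an initial \<^const>\<open>flat\<close> and a final \<^const>\<open>down\<close>.\<close>

lemma Q_paths_iff:
  "w \<in> Q_paths \<longleftrightarrow> successively qfollow (up # w @ [up]) \<and> excursion rise 0 w"
proof -
  let ?v = "up # w @ [up]"
  \<comment> \<open>The leading sentinel shifts all indices by one; at \<open>i = length w\<close>
    the final sentinel is read.\<close>
  have nth: "?v ! Suc i = (if i < length w then w ! i else up)" if "i \<le> length w" for i
    using that by (simp add: nth_append)
  have "successively qfollow ?v \<longleftrightarrow> (\<forall>i\<le>length w. qfollow (?v ! i) (?v ! Suc i))"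
    by (simp add: successively_conv_nth less_Suc_eq_le)
  also have "\<dots> \<longleftrightarrow> (\<forall>i\<le>length w. ?v ! i = down \<longrightarrow> ?v ! Suc i = flat) \<and>
      (\<forall>i\<le>length w. ?v ! Suc i = flat \<longrightarrow> ?v ! i \<noteq> up)"
    unfolding qfollow_def by blast
  also have "(\<forall>i\<le>length w. ?v ! i = down \<longrightarrow> ?v ! Suc i = flat) \<longleftrightarrow>
      (\<forall>i<length w. w ! i = down \<longrightarrow> i + 1 < length w \<and> w ! (i + 1) = flat)" (is "?A \<longleftrightarrow> ?B")
  proof
    assume ?A
    show ?B
    proof (intro allI impI)
      fix i assume i: "i < length w" "w ! i = down"
      then have "?v ! Suc (Suc i) = flat"
        using \<open>?A\<close>[rule_format, of "Suc i"] nth[of i] by simp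
      then show "i + 1 < length w \<and> w ! (i + 1) = flat"
        using i nth[of "Suc i"] by (simp split: if_splits)
    qed
  next
    assume ?B
    show ?A
    proof (intro allI impI)
      fix i assume i: "i \<le> length w" "?v ! i = down"
      then obtain j where j: "i = Suc j" by (cases i) auto
      with i nth[of j] have "w ! j = down" "j < length w" by (auto split: if_splits)
      with \<open>?B\<close> j nth[of i] i show "?v ! Suc i = flat" by simp
    qed
  qed
  also have "(\<forall>i\<le>length w. ?v ! Suc i = flat \<longrightarrow> ?v ! i \<noteq> up) \<longleftrightarrow>
      (\<forall>i<length w. w ! i = flat \<longrightarrow> i > 0 \<and> (w ! (i - 1) = down \<or> w ! (i - 1) = flat))"
    (is "?A \<longleftrightarrow> ?B")
  proof
    assume ?A
    show ?B
    proof (intro allI impI)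
      fix i assume i: "i < length w" "w ! i = flat"
      then have n: "?v ! i \<noteq> up" using \<open>?A\<close>[rule_format, of i] nth[of i] by simp
      then obtain j where j: "i = Suc j" by (cases i) auto
      with n nth[of j] i have "w ! j \<noteq> up" by simp
      with j show "i > 0 \<and> (w ! (i - 1) = down \<or> w ! (i - 1) = flat)"
        by (cases "w ! j") auto
    qed
  next
    assume ?B
    show ?A
    proof (intro allI impI)
      fix i assume i: "i \<le> length w" "?v ! Suc i = flat"
      then have "i < length w" "w ! i = flat" using nth[of i] by (auto split: if_splits)
      moreover from this \<open>?B\<close> obtain j where "i = Suc j" by (cases i) auto
      ultimately show "?v ! i \<noteq> up" using \<open>?B\<close> nth[of j] by auto
    qed
  qed
  finally show ?thesis
    using excursion_iff_prefixes[of 0 rise w]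
    by (auto simp: Q_paths_def fst_position snd_position)
qed

lemma rise_ge: "rise s \<ge> -1"
  by (cases s) auto

lemma Q_path_hd_neq_flat:
  assumes "w \<in> Q_paths" "w \<noteq> []"
  shows "hd w \<noteq> flat"
  using assms by (cases w) (auto simp: Q_paths_iff qfollow_def)

section \<open>Decomposition of quarter-plane paths at the first return to the axis\<close>

lemma qfollow_up_down: "qfollow s up \<longleftrightarrow> qfollow s down"
  by (auto simp: qfollow_def)

text \<open>\<open>qfollow\<close> asks of the second step only whether it is \<open>flat\<close>.
  Hence the final sentinel of a path can be exchanged for the \<open>down\<close> that follows the
  path inside a larger one.\<close>

lemma successively_snoc_up_down:
  "successively qfollow (v @ [up]) \<longleftrightarrow> successively qfollow (v @ [down])"
  by (simp add: successively_append_iff qfollow_up_down)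

lemma successively_split_at:
  "successively P (v @ x # w) \<longleftrightarrow> successively P (v @ [x]) \<and> successively P (x # w)"
  by (auto simp: successively_append_iff)

lemma successively_flats:
  "successively qfollow (flat # replicate j flat @ w) \<longleftrightarrow> successively qfollow (flat # w)"
  by (induction j) (auto simp: qfollow_def)

lemma excursion_flats [simp]:
  "h \<ge> 0 \<Longrightarrow> excursion rise h (replicate j flat @ w) \<longleftrightarrow> excursion rise h w"
  by (induction j) auto

lemma Q_path_node:
  assumes "x \<in> Q_paths" "y \<in> Q_paths"
  shows "up # x @ down # replicate (Suc j) flat @ y \<in> Q_paths"
proof -
  have "successively qfollow ((up # x) @ [down])"
    using assms(1) successively_snoc_up_down[of "up # x"] by (simp add: Q_paths_iff)
  \<comment> \<open>Any step may follow \<open>flat\<close>, so \<open>y\<close> can be attached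
    behind the run.\<close>
  moreover have "successively qfollow (down # replicate (Suc j) flat @ y @ [up])"
    using assms(2) successively_flats[of j "y @ [up]"]
    by (cases y) (auto simp: Q_paths_iff qfollow_def)
  ultimately have "successively qfollow ((up # x) @ down # replicate (Suc j) flat @ y @ [up])"
    using successively_split_at[of qfollow "up # x" down] by blast
  moreover have "excursion rise (0 + 1) (x @ down # replicate (Suc j) flat @ y)"
    by (rule excursion_append) (use assms in \<open>simp_all add: Q_paths_iff\<close>)
  ultimately show ?thesis by (simp add: Q_paths_iff qfollow_def)
qed

lemma leading_flats:
  obtains j y where "w = replicate j flat @ y" "y \<noteq> [] \<Longrightarrow> hd y \<noteq> flat"
proof -
  have "takeWhile ((=) flat) w = replicate (length (takeWhile ((=) flat) w)) flat"
    by (rule replicate_eqI) (auto dest: set_takeWhileD)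
  then have "w = replicate (length (takeWhile ((=) flat) w)) flat @ dropWhile ((=) flat) w"
    using takeWhile_dropWhile_id[of "(=) flat" w] by metis
  moreover have "dropWhile ((=) flat) w \<noteq> [] \<Longrightarrow> hd (dropWhile ((=) flat) w) \<noteq> flat"
    using hd_dropWhile[of "(=) flat" w] by metis
  ultimately show ?thesis using that by blast
qed

lemma replicate_append_inj:
  assumes "replicate i a @ y = replicate j a @ z"
    "y \<noteq> [] \<Longrightarrow> hd y \<noteq> a" "z \<noteq> [] \<Longrightarrow> hd z \<noteq> a"
  shows "i = j \<and> y = z"
  using assms(1)
proof (induction i arbitrary: j)
  case 0
  then show ?case using assms(2) by (cases j) auto
next
  case (Suc i)
  then show ?case using assms(3) by (cases j) auto
qed

text \<open>The first passage from height 1 to 0 isolates \<open>x\<close>. Taking the maximal run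
  of \<open>flat\<close> after it ensures that \<open>y\<close> does not begin with
  \<open>flat\<close> and so is again in \<open>Q_paths\<close>; \<open>Suc j\<close> records that
  the run is nonempty.\<close>

lemma Q_path_cases:
  assumes "w \<in> Q_paths"
  obtains (empty) "w = []"
  | (node) x j y where "w = up # x @ down # replicate (Suc j) flat @ y"
      "x \<in> Q_paths" "y \<in> Q_paths"
proof (cases w)
  case (Cons s t)
  with assms have s: "s = up" by (cases s) (auto simp: Q_paths_iff qfollow_def)
  with assms Cons have ch: "successively qfollow (up # t @ [up])" and ex: "excursion rise 1 t"
    by (auto simp: Q_paths_iff)
  from ex have "excursion rise (0 + 1 + 0) t" by simp
  then obtain x d u where t: "t = x @ d # u" and x: "excursion rise 0 x"
    and d: "rise d = -1" and u: "excursion rise 0 u"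
    by (rule first_passage_exists) (auto simp: rise_ge)
  have "d = down" using d by (cases d) auto
  have "successively qfollow ((up # x) @ down # u @ [up])"
    using ch t \<open>d = down\<close> by simp
  then have chx: "successively qfollow ((up # x) @ [down])" and chu: "successively qfollow (down # u @ [up])"
    using successively_split_at[of qfollow "up # x" down "u @ [up]"] by blast+
  have xQ: "x \<in> Q_paths"
    using chx x successively_snoc_up_down[of "up # x"] by (simp add: Q_paths_iff)
  from chu obtain u' where u': "u = flat # u'" by (cases u) (auto simp: qfollow_def)
  obtain j y where y: "u' = replicate j flat @ y" "y \<noteq> [] \<Longrightarrow> hd y \<noteq> flat"
    by (rule leading_flats[of u']) blast
  have "successively qfollow (flat # y @ [up])"
    using chu u' y(1) successively_flats[of j "y @ [up]"] by simp
  with y(2) have "successively qfollow (up # y @ [up])"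
    by (cases y) (auto simp: qfollow_def)
  with u u' y(1) have "y \<in> Q_paths" by (simp add: Q_paths_iff)
  then show ?thesis using node xQ t Cons s \<open>d = down\<close> u' y(1) by simp
qed (rule empty)

text \<open>First passage determines \<open>x\<close>; then the run length is determined because
  neither remainder begins with \<open>flat\<close>.\<close>

lemma Q_path_node_inj:
  assumes "x @ down # replicate i flat @ y = x' @ down # replicate j flat @ y'"
    "x \<in> Q_paths" "y \<in> Q_paths" "x' \<in> Q_paths" "y' \<in> Q_paths"
  shows "x = x' \<and> i = j \<and> y = y'"
proof -
  have "x = x' \<and> down = down \<and> replicate i flat @ y = replicate j flat @ y'"
    using first_passage_unique[OF assms(1), of rise 0] assms by (auto simp: Q_paths_iff)
  then show ?thesis
    using replicate_append_inj[of i flat y j y'] Q_path_hd_neq_flat assms by blast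
qed


section \<open>The graph of the map\<close>

text \<open>As a relation, \<open>g\<close> can be inverted from either side. The trailing
  \<open>[]\<close> in \<open>case3\<close> and the form \<open>Suc j\<close> of the exponents give
  all nonempty images the shape produced by \<open>Q_path_cases\<close>.\<close>

inductive g_graph :: "step list \<Rightarrow> qstep list \<Rightarrow> bool" where
  empty: "g_graph [] []"
| case1: "g_graph q x \<Longrightarrow> g_graph r y \<Longrightarrow>
    g_graph (U # wpow [F, Fb] k @ Ub # q @ Db # D # r)
      (up # x @ down # replicate (Suc (2 * k + 1)) flat @ y)"
| case2: "g_graph q x \<Longrightarrow> g_graph (U # s) y \<Longrightarrow>
    g_graph (U # wpow [F, Fb] k @ Ub # q @ Db # Fb # s)
      (up # x @ down # replicate (Suc (2 * k)) flat @ y)"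
| case3: "g_graph r x \<Longrightarrow>
    g_graph (U # wpow [F, Fb] k @ F # D # r) (up # x @ down # replicate (Suc (2 * k)) flat @ [])"

lemma Nil_in_Q_paths: "[] \<in> Q_paths"
  by (simp add: Q_paths_iff qfollow_def)

section \<open>The graph as a one-to-one correspondence\<close>

lemma g_graph_in:
  assumes "g_graph p z"
  shows g_graph_packing: "p \<in> packing_paths" and g_graph_Q: "z \<in> Q_paths"
proof -
  from assms have "p \<in> packing_paths \<and> z \<in> Q_paths"
  proof induction
    case empty
    then show ?case using Nil_in_packing_paths Nil_in_Q_paths by blast
  next
    case case1
    then show ?case using packing_path_case1 Q_path_node by blast
  next
    case case2
    then show ?case using packing_path_case2 Q_path_node by blast
  next
    case case3
    then show ?case using packing_path_case3 Q_path_node Nil_in_Q_paths by blast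
  qed
  then show "p \<in> packing_paths" "z \<in> Q_paths" by auto
qed

text \<open>Needed to tell \<open>case2\<close> from \<open>case3\<close> on the image side: in
  \<open>case2\<close> the last factor is the image of a nonempty path.\<close>

lemma g_graph_Nil_iff: "g_graph p z \<Longrightarrow> p = [] \<longleftrightarrow> z = []"
  by (induction rule: g_graph.induct) auto

lemma g_graph_total:
  assumes "p \<in> packing_paths"
  shows "\<exists>z. g_graph p z"
  using assms
proof (induction p rule: length_induct)
  case (1 p)
  from 1(2) show ?case
  proof (cases rule: packing_path_cases)
    case empty
    then show ?thesis using g_graph.empty by blast
  next
    case (case1 k v w)
    then show ?thesis using 1(1)[rule_format, of v] 1(1)[rule_format, of w] g_graph.case1
      by fastforce
  next
    case (case2 k v w)
    \<comment> \<open>\<open>U # w\<close> need not be a factor of \<open>p\<close>, but it is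
      shorter, hence induction on length.\<close>
    then show ?thesis using 1(1)[rule_format, of v] 1(1)[rule_format, of "U # w"] g_graph.case2
      by fastforce
  next
    case (case3 k w)
    then show ?thesis using 1(1)[rule_format, of w] g_graph.case3 by fastforce
  qed
qed

lemma g_graph_surj:
  assumes "z \<in> Q_paths"
  shows "\<exists>p. g_graph p z"
  using assms
proof (induction z rule: length_induct)
  case (1 z)
  from 1(2) show ?case
  proof (cases rule: Q_path_cases)
    case empty
    then show ?thesis using g_graph.empty by blast
  next
    case (node x j y)
    then obtain q r where q: "g_graph q x" and r: "g_graph r y"
      using 1(1)[rule_format, of x] 1(1)[rule_format, of y] by auto
    show ?thesis
    proof (cases "even j")
      case False
      then obtain k where "j = 2 * k + 1" by (auto elim: oddE)
      then show ?thesis using g_graph.case1[OF q r, of k] node(1) by auto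
    next
      case True
      then obtain k where j: "j = 2 * k" by (auto elim: evenE)
      show ?thesis
      proof (cases "y = []")
        case True
        then show ?thesis using g_graph.case3[OF q, of k] node(1) j by auto
      next
        case False
        \<comment> \<open>Since \<open>y\<close> is nonempty, so is its preimage \<open>r\<close>,
          and a nonempty packing path starts with \<open>U\<close>.\<close>
        then obtain s where "r = U # s"
          using g_graph_Nil_iff[OF r] packing_path_nonempty[OF g_graph_packing[OF r]] by blast
        then show ?thesis using g_graph.case2[OF q, of s y k] r node(1) j by auto
      qed
    qed
  qed
qed

text \<open>The initial run and its terminator fix \<open>k\<close> and separate
  \<open>case3\<close>; first passage through \<open>Db\<close> then fixes \<open>q\<close>, and the
  letter after that \<open>Db\<close> separates \<open>case1\<close> from
  \<open>case2\<close>.\<close>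

lemma g_graph_functional: "g_graph p z \<Longrightarrow> g_graph p z' \<Longrightarrow> z = z'"
proof (induction arbitrary: z' rule: g_graph.induct)
  case empty
  then show ?case by (auto elim: g_graph.cases)
next
  case (case1 q x r y k)
  have q: "q \<in> packing_paths" using case1 g_graph_packing by blast
  from case1.prems show ?case
    by (cases rule: g_graph.cases)
      (use case1.IH in \<open>auto simp: packing_path_Db_eq_iff[OF q g_graph_packing]\<close>)
next
  case (case2 q x s y k)
  have q: "q \<in> packing_paths" using case2 g_graph_packing by blast
  from case2.prems show ?case
    by (cases rule: g_graph.cases)
      (use case2.IH in \<open>auto simp: packing_path_Db_eq_iff[OF q g_graph_packing]\<close>)
next
  case (case3 r x k)
  from case3.prems show ?case
    by (cases rule: g_graph.cases) (use case3.IH in auto)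
qed

text \<open>Inversion of the graph at a given image; \<open>Q_path_node_inj\<close> identifies the
  factors from the rule with the given \<open>x\<close>, \<open>j\<close> and
  \<open>y\<close>.\<close>

lemma g_graph_node_elim:
  assumes "g_graph p (up # x @ down # replicate (Suc j) flat @ y)" "x \<in> Q_paths" "y \<in> Q_paths"
  obtains (case1) k q r where "p = U # wpow [F, Fb] k @ Ub # q @ Db # D # r" "j = 2 * k + 1"
      "g_graph q x" "g_graph r y"
  | (case2) k q s where "p = U # wpow [F, Fb] k @ Ub # q @ Db # Fb # s" "j = 2 * k"
      "g_graph q x" "g_graph (U # s) y"
  | (case3) k r where "p = U # wpow [F, Fb] k @ F # D # r" "j = 2 * k" "g_graph r x" "y = []"
  using assms(1)
proof (cases rule: g_graph.cases)
  case (case1 q x' r y' k)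
  then have "x = x' \<and> Suc j = Suc (2 * k + 1) \<and> y = y'"
    using assms(2,3) g_graph_Q by (intro Q_path_node_inj) auto
  then show ?thesis using that(1) case1 by simp
next
  case (case2 q x' s y' k)
  then have "x = x' \<and> Suc j = Suc (2 * k) \<and> y = y'"
    using assms(2,3) g_graph_Q by (intro Q_path_node_inj) auto
  then show ?thesis using that(2) case2 by simp
next
  case (case3 r x' k)
  then have "x = x' \<and> Suc j = Suc (2 * k) \<and> y = []"
    using assms(2,3) g_graph_Q Nil_in_Q_paths by (intro Q_path_node_inj) auto
  then show ?thesis using that(3) case3 by simp
qed

lemma g_graph_inj: "g_graph p z \<Longrightarrow> g_graph p' z \<Longrightarrow> p = p'"
proof (induction arbitrary: p' rule: g_graph.induct)
  case empty
  then show ?case using g_graph_Nil_iff by blast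
next
  case (case1 q x r y k)
  from case1.prems g_graph_Q[OF case1.hyps(1)] g_graph_Q[OF case1.hyps(2)] show ?case
  proof (cases rule: g_graph_node_elim)
    case (case1 k' q' r')
    then show ?thesis using case1.IH by auto
  \<comment> \<open>The other two rules would make the odd number \<open>2 * k + 1\<close>
    even.\<close>
  qed presburger+
next
  case (case2 q x s y k)
  have "y \<noteq> []" using case2.hyps(2) g_graph_Nil_iff by blast
  from case2.prems g_graph_Q[OF case2.hyps(1)] g_graph_Q[OF case2.hyps(2)] show ?case
  proof (cases rule: g_graph_node_elim)
    case case1
    then show ?thesis by presburger
  next
    case (case2 k' q' s')
    then show ?thesis using case2.IH by auto
  next
    case case3
    then show ?thesis using \<open>y \<noteq> []\<close> by simp
  qed
next
  case (case3 r x k)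
  from case3.prems g_graph_Q[OF case3.hyps] Nil_in_Q_paths show ?case
  proof (cases rule: g_graph_node_elim)
    case case1
    then show ?thesis by presburger
  next
    case case2
    \<comment> \<open>Here the empty path would be the image of some \<open>U # s\<close>.\<close>
    then show ?thesis using g_graph_Nil_iff by blast
  next
    case (case3 k' r')
    then show ?thesis using case3.IH by auto
  qed
qed

text \<open>Each recursive equation is a graph rule read at the values of \<open>g\<close>.
  Existence, uniqueness and bijectivity thereby become properties of the graph.\<close>

lemma g_recursion_iff_graph:
  "g_recursion g \<longleftrightarrow> (\<forall>p z. g_graph p z \<longrightarrow> g p = z)"
proof
  assume rec: "g_recursion g"
  have "g p = z" if "g_graph p z" for p z
    using that
  proof induction
    case empty
    then show ?case using rec by (simp add: g_recursion_def)
  next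
    case (case1 q x r y k)
    then have "q \<in> packing_paths" "r \<in> packing_paths" using g_graph_packing by auto
    then show ?case
      using rec packing_path_case1[of q r k] case1.IH by (simp add: g_recursion_def wpow_flat)
  next
    case (case2 q x s y k)
    then have "q \<in> packing_paths" "U # s \<in> packing_paths" using g_graph_packing by auto
    then show ?case
      using rec packing_path_case2[of q s k] case2.IH by (simp add: g_recursion_def wpow_flat)
  next
    case (case3 r x k)
    then have "r \<in> packing_paths" using g_graph_packing by auto
    then show ?case
      using rec packing_path_case3[of r k] case3.IH
      by (simp add: g_recursion_def wpow_flat wpow_rotate)
  qed
  then show "\<forall>p z. g_graph p z \<longrightarrow> g p = z" by blast
next
  assume "\<forall>p z. g_graph p z \<longrightarrow> g p = z"
  then have eq: "g p = z" if "g_graph p z" for p z using that by blast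
  \<comment> \<open>By totality \<open>g p\<close> is itself the value related to \<open>p\<close>,
    so the rules apply with values of \<open>g\<close> as outputs.\<close>
  have gr: "g_graph p (g p)" if "p \<in> packing_paths" for p
    using g_graph_total[OF that] eq by blast
  show "g_recursion g"
    unfolding g_recursion_def
    using eq[OF g_graph.empty] eq[OF g_graph.case1[OF gr gr]] eq[OF g_graph.case2[OF gr gr]]
      eq[OF g_graph.case3[OF gr]]
    by (auto simp: wpow_flat wpow_rotate)
qed

theorem proposition2:
  shows "(\<exists>!g. g \<in> extensional packing_paths \<and> g_recursion g) \<and>
         (\<forall>g. g_recursion g \<longrightarrow> bij_betw g packing_paths Q_paths)"
proof (intro conjI allI impI)
  \<comment> \<open>The recursion constrains \<open>g\<close> only on \<open>packing_paths\<close>;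
    restricting fixes the values elsewhere, which uniqueness requires.\<close>
  let ?g = "restrict (\<lambda>p. THE z. g_graph p z) packing_paths"
  show "\<exists>!g. g \<in> extensional packing_paths \<and> g_recursion g"
  proof (rule ex1I[of _ ?g])
    have "?g p = z" if "g_graph p z" for p z
      using that g_graph_packing[OF that] g_graph_functional by (auto intro: the_equality)
    then show "?g \<in> extensional packing_paths \<and> g_recursion ?g"
      by (simp add: g_recursion_iff_graph)
  next
    fix g assume g: "g \<in> extensional packing_paths \<and> g_recursion g"
    show "g = ?g"
    proof (rule extensionalityI[of _ packing_paths])
      fix p assume p: "p \<in> packing_paths"
      then obtain z where z: "g_graph p z" using g_graph_total by blast
      then have "(THE z. g_graph p z) = z" using g_graph_functional by blast
      moreover have "g p = z" using g z by (simp add: g_recursion_iff_graph)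
      ultimately show "g p = ?g p" using p by simp
    qed (use g in auto)
  qed
next
  fix g assume "g_recursion g"
  then have eq: "g p = z" if "g_graph p z" for p z using that g_recursion_iff_graph by blast
  have gr: "g_graph p (g p)" if "p \<in> packing_paths" for p
    using g_graph_total[OF that] eq by blast
  show "bij_betw g packing_paths Q_paths"
  proof (rule bij_betw_imageI)
    show "inj_on g packing_paths"
      using gr g_graph_inj by (metis inj_onI)
    show "g ` packing_paths = Q_paths"
    proof
      show "g ` packing_paths \<subseteq> Q_paths" using gr g_graph_Q by blast
      show "Q_paths \<subseteq> g ` packing_paths"
        using g_graph_surj g_graph_packing eq by blast
    qed
  qed
qed

end
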